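(* Let $X=(M,J)$ be an almost complex manifold of real dimension $2n$ with a global frame $\{v_1,w_1,\dots,v_n,w_n\}$ of $TM$ such that $Jv_i=w_i$, $Jw_i=-v_i$ for all $i$, let $m\ge1$ be an integer, and let $\alpha_k,\lambda^i_{jk},\beta,R_m,L_m$ be as defined in the context. Consider, for smooth real functions $u,v$ on $M$, the system $$L_m(v)-4mR_m\,v-4m\,\mathrm{Im}(\beta)\,u=0,\qquad -L_m(u)+4mR_m\,u-4m\,\mathrm{Im}(\beta)\,v=0.$$ If $\beta$ is a real valued function, then the system decouples, and $u$ and $v$ satisfy the same second order elliptic equation; that is, $(u,v)$ solves the system if and only if both $h=u$ and $h=v$ satisfy $L_m(h)-4mR_m\,h=0$.
   Context: $J$ is a smooth endomorphism of $TM$ with $J^2=-\mathrm{id}$, not necessarily integrable. Let $\mathcal{X}_k=\frac12(v_k-\sqrt{-1}\,w_k)$ and $\varphi^i=v^i+\sqrt{-1}\,w^i$, with $\{v^i,w^i\}$ the dual coframe. $\bar\partial$ is the component of $d$ mapping $(p,q)$-forms to $(p,q+1)$-forms. The smooth functions $\lambda^i_{jk}$ are defined by $\bar\partial\varphi^i=\sum_{j,k}\lambda^i_{jk}\varphi^j\wedge\bar\varphi^k$, and $\alpha_k=\sum_i\lambda^i_{ik}$. Further $\beta=\sum_{k=1}^n\big(\mathcal{X}_k(\alpha_k)+\sum_{i=1}^n\lambda^i_{kk}\bar\alpha_i\big)$, $R_m=\mathrm{Re}\sum_{k=1}^n\big(\mathcal{X}_k(\alpha_k)-m|\alpha_k|^2-\sum_{i=1}^n\lambda^i_{kk}\bar\alpha_i\big)$,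 and $L_m(h)=\sum_{k=1}^n\big(v_k(v_k(h))+w_k(w_k(h))-4m\,\mathrm{Re}(\alpha_k)v_k(h)-4m\,\mathrm{Im}(\alpha_k)w_k(h)-2\sum_{i=1}^n\mathrm{Re}(\lambda^i_{kk})v_i(h)-2\sum_{i=1}^n\mathrm{Im}(\lambda^i_{kk})w_i(h)\big)$, a second order elliptic operator. Here $v$ without index is a function, $v_k$ a vector field. *)

theory Defs
  imports "HOL-Analysis.Analysis"
begin

section \<open>Smooth manifolds and vector fields\<close>

fun Ck_on :: "nat \<Rightarrow> 'e::euclidean_space set \<Rightarrow> ('e \<Rightarrow> 'b::real_normed_vector) \<Rightarrow> bool" where
  "Ck_on 0 S f \<longleftrightarrow> continuous_on S f"
| "Ck_on (Suc k) S f \<longleftrightarrow>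
     (\<forall>x\<in>S. f differentiable (at x)) \<and>
     (\<forall>y. Ck_on k S (\<lambda>x. frechet_derivative f (at x) y))"

definition smooth_on :: "'e::euclidean_space set \<Rightarrow> ('e \<Rightarrow> 'b::real_normed_vector) \<Rightarrow> bool" where
  "smooth_on S f \<longleftrightarrow> (\<forall>k. Ck_on k S f)"

text \<open>
  The underlying set of the manifold is the whole type \<open>'a\<close>; the Hausdorff and second
  countability axioms are carried by its sort. An atlas is a set of pairs (domain, chart map);
  the chart map is only relevant on its domain. The real dimension is \<open>DIM('e)\<close>.
\<close>

type_synonym ('a, 'e) atlas = "('a set \<times> ('a \<Rightarrow> 'e)) set"

definition smooth_manifold ::
  "('a::{t2_space,second_countable_topology}, 'e::euclidean_space) atlas \<Rightarrow> bool" where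
  "smooth_manifold A \<longleftrightarrow>
     (\<Union>(U, \<phi>)\<in>A. U) = UNIV \<and>
     (\<forall>(U, \<phi>)\<in>A. open U \<and> open (\<phi> ` U) \<and> (\<exists>\<psi>. homeomorphism U (\<phi> ` U) \<phi> \<psi>)) \<and>
     (\<forall>(U, \<phi>)\<in>A. \<forall>(U', \<phi>')\<in>A. smooth_on (\<phi> ` (U \<inter> U')) (\<phi>' \<circ> inv_into U \<phi>))"

definition smooth_fun ::
  "('a, 'e::euclidean_space) atlas \<Rightarrow> ('a \<Rightarrow> 'b::real_normed_vector) \<Rightarrow> bool" where
  "smooth_fun A f \<longleftrightarrow> (\<forall>(U, \<phi>)\<in>A. smooth_on (\<phi> ` U) (f \<circ> inv_into U \<phi>))"

text \<open>
  Tangent vectors at \<open>p\<close> are the derivations at \<open>p\<close> of the algebra of smooth real functions.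
  Requiring the value \<open>0\<close> on non-smooth arguments makes a derivation determined, as a HOL
  function, by its values on smooth functions.
\<close>

type_synonym 'a tvec = "('a \<Rightarrow> real) \<Rightarrow> real"
type_synonym 'a vfield = "'a \<Rightarrow> 'a tvec"

definition tangent_space :: "('a, 'e::euclidean_space) atlas \<Rightarrow> 'a \<Rightarrow> 'a tvec set" where
  "tangent_space A p = {D.
     (\<forall>f g. smooth_fun A f \<longrightarrow> smooth_fun A g \<longrightarrow> D (\<lambda>x. f x + g x) = D f + D g) \<and>
     (\<forall>c f. smooth_fun A f \<longrightarrow> D (\<lambda>x. c * f x) = c * D f) \<and>
     (\<forall>f g. smooth_fun A f \<longrightarrow> smooth_fun A g \<longrightarrow> D (\<lambda>x. f x * g x) = f p * D g + D f * g p) \<and>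
     (\<forall>f. \<not> smooth_fun A f \<longrightarrow> D f = 0)}"

definition smooth_vfield :: "('a, 'e::euclidean_space) atlas \<Rightarrow> 'a vfield \<Rightarrow> bool" where
  "smooth_vfield A X \<longleftrightarrow>
     (\<forall>p. X p \<in> tangent_space A p) \<and>
     (\<forall>f. smooth_fun A f \<longrightarrow> smooth_fun A (\<lambda>p. X p f))"

definition lie_bracket :: "'a vfield \<Rightarrow> 'a vfield \<Rightarrow> 'a vfield" where
  "lie_bracket X Y = (\<lambda>p f. X p (\<lambda>q. Y q f) - Y p (\<lambda>q. X q f))"

definition tvec_capply :: "'a tvec \<Rightarrow> ('a \<Rightarrow> complex) \<Rightarrow> complex" where
  "tvec_capply D g = Complex (D (\<lambda>q. Re (g q))) (D (\<lambda>q. Im (g q)))"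

definition tangent_linear ::
  "('a, 'e::euclidean_space) atlas \<Rightarrow> 'a \<Rightarrow> ('a tvec \<Rightarrow> real) \<Rightarrow> bool" where
  "tangent_linear A p \<theta> \<longleftrightarrow>
     (\<forall>D\<in>tangent_space A p. \<forall>E\<in>tangent_space A p. \<theta> (\<lambda>f. D f + E f) = \<theta> D + \<theta> E) \<and>
     (\<forall>c. \<forall>D\<in>tangent_space A p. \<theta> (\<lambda>f. c * D f) = c * \<theta> D)"

definition almost_complex_structure ::
  "('a, 'e::euclidean_space) atlas \<Rightarrow> ('a \<Rightarrow> 'a tvec \<Rightarrow> 'a tvec) \<Rightarrow> bool" where
  "almost_complex_structure A J \<longleftrightarrow>
     (\<forall>p. \<forall>D\<in>tangent_space A p. J p D \<in> tangent_space A p) \<and>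
     (\<forall>p. \<forall>D\<in>tangent_space A p. \<forall>E\<in>tangent_space A p.
        J p (\<lambda>f. D f + E f) = (\<lambda>f. J p D f + J p E f)) \<and>
     (\<forall>p c. \<forall>D\<in>tangent_space A p. J p (\<lambda>f. c * D f) = (\<lambda>f. c * J p D f)) \<and>
     (\<forall>X. smooth_vfield A X \<longrightarrow> smooth_vfield A (\<lambda>p. J p (X p))) \<and>
     (\<forall>p. \<forall>D\<in>tangent_space A p. J p (J p D) = (\<lambda>f. - D f))"

text \<open>\<open>V\<close> and \<open>W\<close> are indexed by \<open>{1..n}\<close>; values at other indices are irrelevant.\<close>

definition global_frame ::
  "('a, 'e::euclidean_space) atlas \<Rightarrow> nat \<Rightarrow> (nat \<Rightarrow> 'a vfield) \<Rightarrow> (nat \<Rightarrow> 'a vfield) \<Rightarrow> bool" where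
  "global_frame A n V W \<longleftrightarrow>
     (\<forall>i\<in>{1..n}. smooth_vfield A (V i) \<and> smooth_vfield A (W i)) \<and>
     (\<forall>p. \<forall>D\<in>tangent_space A p. \<exists>a b. D = (\<lambda>f. \<Sum>i=1..n. a i * V i p f + b i * W i p f)) \<and>
     (\<forall>p a b. (\<lambda>f. \<Sum>i=1..n. a i * V i p f + b i * W i p f) = (\<lambda>f. 0) \<longrightarrow>
        (\<forall>i\<in>{1..n}. a i = 0 \<and> b i = 0))"

definition dual_coframe ::
  "('a, 'e::euclidean_space) atlas \<Rightarrow> nat \<Rightarrow> (nat \<Rightarrow> 'a vfield) \<Rightarrow> (nat \<Rightarrow> 'a vfield) \<Rightarrow>
   (nat \<Rightarrow> 'a \<Rightarrow> 'a tvec \<Rightarrow> real) \<Rightarrow> (nat \<Rightarrow> 'a \<Rightarrow> 'a tvec \<Rightarrow> real) \<Rightarrow> bool" where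
  "dual_coframe A n V W Vd Wd \<longleftrightarrow>
     (\<forall>i\<in>{1..n}. \<forall>p. tangent_linear A p (Vd i p) \<and> tangent_linear A p (Wd i p) \<and>
        (\<forall>j\<in>{1..n}. Vd i p (V j p) = (if i = j then 1 else 0) \<and> Vd i p (W j p) = 0 \<and>
                    Wd i p (V j p) = 0 \<and> Wd i p (W j p) = (if i = j then 1 else 0)))"


section \<open>Complex-valued forms and the dbar operator\<close>

text \<open>
  A complex 1-form is a family of complex-valued functionals on the tangent spaces. A complex
  2-form is given by its values on pairs of smooth vector fields. Normalisations of \<open>wedge\<close> and
  \<open>ext_d\<close> are the usual compatible ones, without factors 1/2.
\<close>

type_synonym 'a cform1 = "'a \<Rightarrow> 'a tvec \<Rightarrow> complex"
type_synonym 'a cform2 = "'a vfield \<Rightarrow> 'a vfield \<Rightarrow> 'a \<Rightarrow> complex"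

definition wedge :: "'a cform1 \<Rightarrow> 'a cform1 \<Rightarrow> 'a cform2" where
  "wedge \<theta> \<eta> = (\<lambda>X Y p. \<theta> p (X p) * \<eta> p (Y p) - \<theta> p (Y p) * \<eta> p (X p))"

definition ext_d :: "'a cform1 \<Rightarrow> 'a cform2" where
  "ext_d \<theta> = (\<lambda>X Y p. tvec_capply (X p) (\<lambda>q. \<theta> q (Y q)) - tvec_capply (Y p) (\<lambda>q. \<theta> q (X q))
                       - \<theta> p (lie_bracket X Y p))"

text \<open>A complex vector field \<open>X + \<i> Y\<close> is represented by the pair \<open>(X, Y)\<close> of real ones.\<close>

type_synonym 'a cvfield = "'a vfield \<times> 'a vfield"

definition cvfield_apply :: "'a cvfield \<Rightarrow> ('a \<Rightarrow> complex) \<Rightarrow> 'a \<Rightarrow> complex" where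
  "cvfield_apply Z g p = tvec_capply (fst Z p) g + \<i> * tvec_capply (snd Z p) g"

definition cform2_ext :: "'a cform2 \<Rightarrow> 'a cvfield \<Rightarrow> 'a cvfield \<Rightarrow> 'a \<Rightarrow> complex" where
  "cform2_ext \<omega> Z Z' p =
     \<omega> (fst Z) (fst Z') p - \<omega> (snd Z) (snd Z') p
     + \<i> * (\<omega> (fst Z) (snd Z') p + \<omega> (snd Z) (fst Z') p)"

text \<open>The components \<open>(X - \<i> J X) / 2\<close> and \<open>(X + \<i> J X) / 2\<close> of a real vector field \<open>X\<close>.\<close>

definition part10 :: "('a \<Rightarrow> 'a tvec \<Rightarrow> 'a tvec) \<Rightarrow> 'a vfield \<Rightarrow> 'a cvfield" where
  "part10 J X = ((\<lambda>p f. X p f / 2), (\<lambda>p f. - J p (X p) f / 2))"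

definition part01 :: "('a \<Rightarrow> 'a tvec \<Rightarrow> 'a tvec) \<Rightarrow> 'a vfield \<Rightarrow> 'a cvfield" where
  "part01 J X = ((\<lambda>p f. X p f / 2), (\<lambda>p f. J p (X p) f / 2))"

definition component11 :: "('a \<Rightarrow> 'a tvec \<Rightarrow> 'a tvec) \<Rightarrow> 'a cform2 \<Rightarrow> 'a cform2" where
  "component11 J \<omega> = (\<lambda>X Y p. cform2_ext \<omega> (part10 J X) (part01 J Y) p
                              + cform2_ext \<omega> (part01 J X) (part10 J Y) p)"

text \<open>
  The operator dbar on (1,0)-forms, the only bidegree that is needed: the (1,1)-component of
  the exterior derivative.
\<close>

definition dbar :: "('a \<Rightarrow> 'a tvec \<Rightarrow> 'a tvec) \<Rightarrow> 'a cform1 \<Rightarrow> 'a cform2" where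
  "dbar J \<theta> = component11 J (ext_d \<theta>)"

definition phi ::
  "(nat \<Rightarrow> 'a \<Rightarrow> 'a tvec \<Rightarrow> real) \<Rightarrow> (nat \<Rightarrow> 'a \<Rightarrow> 'a tvec \<Rightarrow> real) \<Rightarrow> nat \<Rightarrow> 'a cform1" where
  "phi Vd Wd i = (\<lambda>p D. complex_of_real (Vd i p D) + \<i> * complex_of_real (Wd i p D))"

definition cnj_form :: "'a cform1 \<Rightarrow> 'a cform1" where
  "cnj_form \<theta> = (\<lambda>p D. cnj (\<theta> p D))"

text \<open>\<open>lam i j k\<close> has upper index \<open>i\<close> and lower indices \<open>j k\<close>.\<close>

definition structure_functions ::
  "('a, 'e::euclidean_space) atlas \<Rightarrow> ('a \<Rightarrow> 'a tvec \<Rightarrow> 'a tvec) \<Rightarrow> nat \<Rightarrow>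
   (nat \<Rightarrow> 'a \<Rightarrow> 'a tvec \<Rightarrow> real) \<Rightarrow> (nat \<Rightarrow> 'a \<Rightarrow> 'a tvec \<Rightarrow> real) \<Rightarrow>
   (nat \<Rightarrow> nat \<Rightarrow> nat \<Rightarrow> 'a \<Rightarrow> complex) \<Rightarrow> bool" where
  "structure_functions A J n Vd Wd lam \<longleftrightarrow>
     (\<forall>i\<in>{1..n}. \<forall>j\<in>{1..n}. \<forall>k\<in>{1..n}. smooth_fun A (lam i j k)) \<and>
     (\<forall>i\<in>{1..n}. \<forall>X Y p. smooth_vfield A X \<longrightarrow> smooth_vfield A Y \<longrightarrow>
        dbar J (phi Vd Wd i) X Y p =
          (\<Sum>j=1..n. \<Sum>k=1..n.
             lam i j k p * wedge (phi Vd Wd j) (cnj_form (phi Vd Wd k)) X Y p))"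


section \<open>The functions and the operator in the system\<close>

definition XX :: "(nat \<Rightarrow> 'a vfield) \<Rightarrow> (nat \<Rightarrow> 'a vfield) \<Rightarrow> nat \<Rightarrow> 'a cvfield" where
  "XX V W k = ((\<lambda>p f. V k p f / 2), (\<lambda>p f. - W k p f / 2))"

definition alpha :: "nat \<Rightarrow> (nat \<Rightarrow> nat \<Rightarrow> nat \<Rightarrow> 'a \<Rightarrow> complex) \<Rightarrow> nat \<Rightarrow> 'a \<Rightarrow> complex" where
  "alpha n lam k p = (\<Sum>i=1..n. lam i i k p)"

definition beta ::
  "nat \<Rightarrow> (nat \<Rightarrow> 'a vfield) \<Rightarrow> (nat \<Rightarrow> 'a vfield) \<Rightarrow>
   (nat \<Rightarrow> nat \<Rightarrow> nat \<Rightarrow> 'a \<Rightarrow> complex) \<Rightarrow> 'a \<Rightarrow> complex" where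
  "beta n V W lam p =
     (\<Sum>k=1..n. cvfield_apply (XX V W k) (alpha n lam k) p
              + (\<Sum>i=1..n. lam i k k p * cnj (alpha n lam i p)))"

definition R_fun ::
  "nat \<Rightarrow> (nat \<Rightarrow> 'a vfield) \<Rightarrow> (nat \<Rightarrow> 'a vfield) \<Rightarrow>
   (nat \<Rightarrow> nat \<Rightarrow> nat \<Rightarrow> 'a \<Rightarrow> complex) \<Rightarrow> nat \<Rightarrow> 'a \<Rightarrow> real" where
  "R_fun n V W lam m p =
     Re (\<Sum>k=1..n. cvfield_apply (XX V W k) (alpha n lam k) p
              - of_nat m * complex_of_real ((cmod (alpha n lam k p))\<^sup>2)
              - (\<Sum>i=1..n. lam i k k p * cnj (alpha n lam i p)))"

definition L_op ::
  "nat \<Rightarrow> (nat \<Rightarrow> 'a vfield) \<Rightarrow> (nat \<Rightarrow> 'a vfield) \<Rightarrow>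
   (nat \<Rightarrow> nat \<Rightarrow> nat \<Rightarrow> 'a \<Rightarrow> complex) \<Rightarrow> nat \<Rightarrow> ('a \<Rightarrow> real) \<Rightarrow> 'a \<Rightarrow> real" where
  "L_op n V W lam m h p =
     (\<Sum>k=1..n. V k p (\<lambda>q. V k q h) + W k p (\<lambda>q. W k q h)
        - 4 * real m * Re (alpha n lam k p) * V k p h
        - 4 * real m * Im (alpha n lam k p) * W k p h
        - 2 * (\<Sum>i=1..n. Re (lam i k k p) * V i p h)
        - 2 * (\<Sum>i=1..n. Im (lam i k k p) * W i p h))"

text \<open>
  Differential operators on smooth real functions are described by iterated commutators with
  multiplication operators. For \<open>P\<close> of order at most 2, the function \<open>[[P, f], f] 1 / 2\<close>
  at \<open>p\<close> is the principal symbol of \<open>P\<close> (without factors of \<open>\<i>\<close>) at the covector \<open>df\<close> at \<open>p\<close>.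
\<close>

definition mult_commutator ::
  "(('a \<Rightarrow> real) \<Rightarrow> 'a \<Rightarrow> real) \<Rightarrow> ('a \<Rightarrow> real) \<Rightarrow> ('a \<Rightarrow> real) \<Rightarrow> 'a \<Rightarrow> real" where
  "mult_commutator P f = (\<lambda>h p. P (\<lambda>q. f q * h q) p - f p * P h p)"

definition diff_operator_order2 ::
  "('a, 'e::euclidean_space) atlas \<Rightarrow> (('a \<Rightarrow> real) \<Rightarrow> 'a \<Rightarrow> real) \<Rightarrow> bool" where
  "diff_operator_order2 A P \<longleftrightarrow>
     (\<forall>h. smooth_fun A h \<longrightarrow> smooth_fun A (P h)) \<and>
     (\<forall>g h. smooth_fun A g \<longrightarrow> smooth_fun A h \<longrightarrow> P (\<lambda>q. g q + h q) = (\<lambda>p. P g p + P h p)) \<and>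
     (\<forall>c h. smooth_fun A h \<longrightarrow> P (\<lambda>q. c * h q) = (\<lambda>p. c * P h p)) \<and>
     (\<forall>f1 f2 f3 h. smooth_fun A f1 \<longrightarrow> smooth_fun A f2 \<longrightarrow> smooth_fun A f3 \<longrightarrow> smooth_fun A h \<longrightarrow>
        mult_commutator (mult_commutator (mult_commutator P f1) f2) f3 h = (\<lambda>p. 0))"

definition principal_symbol2 ::
  "(('a \<Rightarrow> real) \<Rightarrow> 'a \<Rightarrow> real) \<Rightarrow> ('a \<Rightarrow> real) \<Rightarrow> 'a \<Rightarrow> real" where
  "principal_symbol2 P f p = mult_commutator (mult_commutator P f) f (\<lambda>q. 1) p / 2"

definition elliptic_order2 ::
  "('a, 'e::euclidean_space) atlas \<Rightarrow> (('a \<Rightarrow> real) \<Rightarrow> 'a \<Rightarrow> real) \<Rightarrow> bool" where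
  "elliptic_order2 A P \<longleftrightarrow>
     diff_operator_order2 A P \<and>
     (\<forall>p f. smooth_fun A f \<longrightarrow> (\<exists>D\<in>tangent_space A p. D f \<noteq> 0) \<longrightarrow> principal_symbol2 P f p \<noteq> 0)"

end

theory Submission
  imports Defs
begin

text \<open>
  The operator has the form \<open>P h = \<Sum>\<^sub>k X\<^sub>k (X\<^sub>k h) + Y h + c h\<close>, where the \<open>X\<^sub>k\<close> run through the
  frame, \<open>Y\<close> is a smooth vector field and \<open>c\<close> a smooth function. The Leibniz rule gives
  \<open>[[P, f], g] h = 2 h \<Sum>\<^sub>k X\<^sub>k f \<cdot> X\<^sub>k g\<close>. Hence \<open>P\<close> has order two and its symbol at \<open>df\<close> is
  \<open>\<Sum>\<^sub>k (X\<^sub>k f)\<^sup>2\<close>, which vanishes only if \<open>df = 0\<close> because the frame spans the tangent space.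
  The coupling terms of the system carry the factor \<open>Im \<beta>\<close>, which is zero for real \<open>\<beta>\<close>.
\<close>

section \<open>Smooth functions\<close>

text \<open>The filter \<open>at x\<close> sees only points of the open set \<open>S\<close> near
  \<open>x\<close>, so functions equal on \<open>S\<close> have equal derivatives there. The
  induction generalises over both functions because it continues with their directional
  derivatives.\<close>

lemma Ck_on_cong:
  assumes "open S" "\<And>x. x \<in> S \<Longrightarrow> f x = g x" "Ck_on k S f"
  shows "Ck_on k S g"
  using assms(2,3)
proof (induction k arbitrary: f g)
  case 0
  then show ?case
    using continuous_on_eq[of S f g] by simp
next
  case (Suc k)
  have f: "(f has_derivative frechet_derivative f (at x)) (at x)" if "x \<in> S" for x
    using Suc.prems(2) that by (simp flip: frechet_derivative_works)
  have der: "(g has_derivative frechet_derivative f (at x)) (at x)" if "x \<in> S" for x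
    by (rule has_derivative_transform_within_open[OF f[OF that] \<open>open S\<close> that Suc.prems(1)])
  have eq: "frechet_derivative f (at x) y = frechet_derivative g (at x) y" if "x \<in> S" for x y
    using frechet_derivative_at[OF der[OF that]] by simp
  have "Ck_on k S (\<lambda>x. frechet_derivative f (at x) y)" for y
    using Suc.prems(2) by simp
  then have "Ck_on k S (\<lambda>x. frechet_derivative g (at x) y)" for y
    by (rule Suc.IH[rotated]) (rule eq)
  then show ?case
    using der unfolding Ck_on.simps differentiable_def by blast
qed

lemma smooth_on_has_derivative:
  "smooth_on S f \<Longrightarrow> x \<in> S \<Longrightarrow> (f has_derivative frechet_derivative f (at x)) (at x)"
  unfolding smooth_on_def by (metis Ck_on.simps(2) frechet_derivative_works)

lemma smooth_on_frechet_derivative: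
  "smooth_on S f \<Longrightarrow> smooth_on S (\<lambda>x. frechet_derivative f (at x) y)"
  unfolding smooth_on_def by (metis Ck_on.simps(2))

lemma smooth_on_imp_continuous_on: "smooth_on S f \<Longrightarrow> continuous_on S f"
  unfolding smooth_on_def by (metis Ck_on.simps(1))

text \<open>\<open>Ck_on\<close> speaks of \<open>frechet_derivative\<close>, whereas the
  differentiation rules produce explicit formulas \<open>f'\<close>. Uniqueness of the derivative
  joins the two, so the closure proofs below can work with the formulas.\<close>

lemma Ck_on_SucI:
  assumes "open S" "\<And>x. x \<in> S \<Longrightarrow> (f has_derivative f' x) (at x)"
    and "\<And>y. Ck_on k S (\<lambda>x. f' x y)"
  shows "Ck_on (Suc k) S f"
proof -
  have "f' x = frechet_derivative f (at x)" if "x \<in> S" for x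
    using assms(2) that frechet_derivative_at by blast
  then have "Ck_on k S (\<lambda>x. frechet_derivative f (at x) y)" for y
    by (intro Ck_on_cong[OF \<open>open S\<close> _ assms(3)[of y]]) auto
  then show ?thesis
    using assms(2) unfolding Ck_on.simps differentiable_def by blast
qed

lemma smooth_on_const: "smooth_on S (\<lambda>x. c)"
proof -
  have "Ck_on k S (\<lambda>x. c)" for k
    by (induction k arbitrary: c) auto
  then show ?thesis by (simp add: smooth_on_def)
qed

text \<open>Stated at a fixed order \<open>k\<close>, since the product rule needs it inside an
  induction on \<open>k\<close>.\<close>

lemma Ck_on_add:
  assumes "open S" "Ck_on k S f" "Ck_on k S g"
  shows "Ck_on k S (\<lambda>x. f x + g x)"
  using assms(2,3)
proof (induction k arbitrary: f g)
  case 0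
  then show ?case by (auto intro: continuous_intros)
next
  case (Suc k)
  show ?case
    by (rule Ck_on_SucI[OF \<open>open S\<close> has_derivative_add])
      (use Suc in \<open>auto simp: frechet_derivative_works\<close>)
qed

lemma smooth_on_add:
  "open S \<Longrightarrow> smooth_on S f \<Longrightarrow> smooth_on S g \<Longrightarrow> smooth_on S (\<lambda>x. f x + g x)"
  by (auto simp: smooth_on_def intro: Ck_on_add)

lemma smooth_on_bounded_linear:
  assumes "open S" "bounded_linear h" "smooth_on S f"
  shows "smooth_on S (\<lambda>x. h (f x))"
proof -
  have "Ck_on k S (\<lambda>x. h (f x))" for k
    using assms(3)
  proof (induction k arbitrary: f)
    case 0
    then show ?case
      using bounded_linear.continuous_on[OF assms(2)] smooth_on_imp_continuous_on by auto
  next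
    case (Suc k)
    show ?case
    proof (rule Ck_on_SucI[OF \<open>open S\<close> bounded_linear.has_derivative[OF assms(2)]])
      show "(f has_derivative frechet_derivative f (at x)) (at x)" if "x \<in> S" for x
        using smooth_on_has_derivative[OF Suc.prems that] .
      show "Ck_on k S (\<lambda>x. h (frechet_derivative f (at x) y))" for y
        by (intro Suc.IH smooth_on_frechet_derivative Suc.prems)
    qed
  qed
  then show ?thesis by (simp add: smooth_on_def)
qed

text \<open>The product rule involves the factors themselves as well as their derivatives. Assuming
  full smoothness throughout the induction covers both, without passing from order
  \<open>Suc k\<close> to order \<open>k\<close>.\<close>

lemma smooth_on_mult:
  fixes f g :: "'e::euclidean_space \<Rightarrow> 'b::real_normed_algebra"
  assumes "open S" "smooth_on S f" "smooth_on S g"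
  shows "smooth_on S (\<lambda>x. f x * g x)"
proof -
  have "Ck_on k S (\<lambda>x. f x * g x)" for k
    using assms(2,3)
  proof (induction k arbitrary: f g)
    case 0
    then show ?case
      using smooth_on_imp_continuous_on by (auto intro: continuous_on_mult)
  next
    case (Suc k)
    show ?case
    proof (rule Ck_on_SucI[OF \<open>open S\<close> has_derivative_mult])
      show "(f has_derivative frechet_derivative f (at x)) (at x)"
        "(g has_derivative frechet_derivative g (at x)) (at x)" if "x \<in> S" for x
        using Suc.prems that by (auto intro: smooth_on_has_derivative)
      show "Ck_on k S (\<lambda>x. f x * frechet_derivative g (at x) y
          + frechet_derivative f (at x) y * g x)" for y
        by (intro Ck_on_add[OF \<open>open S\<close>] Suc.IH smooth_on_frechet_derivative Suc.prems)
    qed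
  qed
  then show ?thesis by (simp add: smooth_on_def)
qed

section \<open>Smooth functions on the manifold, read in charts\<close>

lemma smooth_fun_const: "smooth_fun A (\<lambda>x. c)"
  by (auto simp: smooth_fun_def comp_def smooth_on_const)

lemma smooth_manifold_open_chart: "smooth_manifold A \<Longrightarrow> (U, \<phi>) \<in> A \<Longrightarrow> open (\<phi> ` U)"
  unfolding smooth_manifold_def by blast

lemma smooth_fun_add:
  assumes "smooth_manifold A" "smooth_fun A f" "smooth_fun A g"
  shows "smooth_fun A (\<lambda>x. f x + g x)"
  using assms(2,3) smooth_manifold_open_chart[OF assms(1)]
  by (force simp: smooth_fun_def comp_def intro: smooth_on_add)

lemma smooth_fun_mult:
  fixes f g :: "_ \<Rightarrow> 'b::real_normed_algebra"
  assumes "smooth_manifold A" "smooth_fun A f" "smooth_fun A g"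
  shows "smooth_fun A (\<lambda>x. f x * g x)"
  using assms(2,3) smooth_manifold_open_chart[OF assms(1)]
  by (force simp: smooth_fun_def comp_def intro: smooth_on_mult)

text \<open>Used for negation, and for \<open>Re\<close> and \<open>Im\<close>, which turn the
  complex structure functions into real coefficients.\<close>

lemma smooth_fun_bounded_linear:
  assumes "smooth_manifold A" "bounded_linear h" "smooth_fun A f"
  shows "smooth_fun A (\<lambda>x. h (f x))"
  unfolding smooth_fun_def
proof clarify
  fix U \<phi>
  assume U: "(U, \<phi>) \<in> A"
  then have "smooth_on (\<phi> ` U) (\<lambda>y. f (inv_into U \<phi> y))"
    using assms(3) by (auto simp: smooth_fun_def comp_def)
  from smooth_on_bounded_linear[OF smooth_manifold_open_chart[OF assms(1) U] assms(2) this]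
  show "smooth_on (\<phi> ` U) ((\<lambda>x. h (f x)) \<circ> inv_into U \<phi>)"
    by (simp add: comp_def)
qed

lemma smooth_fun_minus:
  assumes "smooth_manifold A" "smooth_fun A f"
  shows "smooth_fun A (\<lambda>x. - f x)"
  using smooth_fun_bounded_linear[OF assms(1) bounded_linear_minus[OF bounded_linear_ident] assms(2)] .

lemma smooth_fun_diff:
  assumes "smooth_manifold A" "smooth_fun A f" "smooth_fun A g"
  shows "smooth_fun A (\<lambda>x. f x - g x)"
  using smooth_fun_add[OF assms(1,2) smooth_fun_minus[OF assms(1,3)]] by simp

lemma smooth_fun_sum:
  assumes "smooth_manifold A" "\<And>i. i \<in> I \<Longrightarrow> smooth_fun A (f i)"
  shows "smooth_fun A (\<lambda>x. \<Sum>i\<in>I. f i x)"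
  using assms(2)
  by (induction I rule: infinite_finite_induct)
    (auto intro: smooth_fun_const smooth_fun_add[OF assms(1)])

section \<open>Smooth vector fields\<close>

lemma smooth_vfield_smooth_fun:
  "smooth_vfield A X \<Longrightarrow> smooth_fun A f \<Longrightarrow> smooth_fun A (\<lambda>p. X p f)"
  by (simp add: smooth_vfield_def)

lemma smooth_vfield_apply_add:
  "smooth_vfield A X \<Longrightarrow> smooth_fun A f \<Longrightarrow> smooth_fun A g \<Longrightarrow>
    X p (\<lambda>x. f x + g x) = X p f + X p g"
  by (simp add: smooth_vfield_def tangent_space_def)

lemma smooth_vfield_apply_scale:
  "smooth_vfield A X \<Longrightarrow> smooth_fun A f \<Longrightarrow> X p (\<lambda>x. c * f x) = c * X p f"
  by (simp add: smooth_vfield_def tangent_space_def)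

lemma smooth_vfield_apply_mult:
  "smooth_vfield A X \<Longrightarrow> smooth_fun A f \<Longrightarrow> smooth_fun A g \<Longrightarrow>
    X p (\<lambda>x. f x * g x) = f p * X p g + X p f * g p"
  by (simp add: smooth_vfield_def tangent_space_def)

lemma smooth_vfield_zero: "smooth_vfield A (\<lambda>p f. 0)"
  by (simp add: smooth_vfield_def tangent_space_def smooth_fun_const)

lemma smooth_vfield_add:
  assumes "smooth_manifold A" "smooth_vfield A X" "smooth_vfield A Y"
  shows "smooth_vfield A (\<lambda>p f. X p f + Y p f)"
  using assms by (auto simp: smooth_vfield_def tangent_space_def algebra_simps intro: smooth_fun_add)

lemma smooth_vfield_mult:
  assumes "smooth_manifold A" "smooth_fun A b" "smooth_vfield A X"
  shows "smooth_vfield A (\<lambda>p f. b p * X p f)"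
  using assms by (auto simp: smooth_vfield_def tangent_space_def algebra_simps intro: smooth_fun_mult)

lemma smooth_vfield_sum:
  assumes "smooth_manifold A" "\<And>i. i \<in> I \<Longrightarrow> smooth_vfield A (X i)"
  shows "smooth_vfield A (\<lambda>p f. \<Sum>i\<in>I. X i p f)"
  using assms(2)
  by (induction I rule: infinite_finite_induct)
    (auto intro: smooth_vfield_zero smooth_vfield_add[OF assms(1)])

section \<open>Sums of squares of vector fields\<close>

text \<open>The index type is left free so that the two halves of a frame can later be joined into
  one family over a disjoint sum. The function \<open>c\<close> will carry the term in
  \<open>R_fun\<close>.\<close>

locale sum_of_squares =
  fixes A :: "('a::{t2_space,second_countable_topology}, 'e::euclidean_space) atlas"
    and I :: "'i set" and X :: "'i \<Rightarrow> 'a vfield" and Y :: "'a vfield" and c :: "'a \<Rightarrow> real"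
  assumes man: "smooth_manifold A"
    and X: "\<And>i. i \<in> I \<Longrightarrow> smooth_vfield A (X i)"
    and Y: "smooth_vfield A Y"
    and c: "smooth_fun A c"
begin

definition P :: "('a \<Rightarrow> real) \<Rightarrow> 'a \<Rightarrow> real" where
  "P h p = (\<Sum>i\<in>I. X i p (\<lambda>q. X i q h)) + Y p h + c p * h p"

lemmas smooth_intros = smooth_fun_add[OF man] smooth_fun_mult[OF man] smooth_fun_sum[OF man]
  smooth_vfield_smooth_fun[OF X] smooth_vfield_smooth_fun[OF Y] c smooth_fun_const

lemma smooth_P: "smooth_fun A h \<Longrightarrow> smooth_fun A (P h)"
  unfolding P_def[abs_def] by (intro smooth_intros) auto

lemma P_add:
  assumes "smooth_fun A g" "smooth_fun A h"
  shows "P (\<lambda>q. g q + h q) p = P g p + P h p"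
proof -
  have "X i p (\<lambda>q. X i q (\<lambda>q. g q + h q)) = X i p (\<lambda>q. X i q g) + X i p (\<lambda>q. X i q h)"
    if "i \<in> I" for i
    using that assms by (simp add: smooth_vfield_apply_add[OF X] smooth_intros)
  then show ?thesis
    using assms by (simp add: P_def smooth_vfield_apply_add[OF Y] sum.distrib algebra_simps)
qed

lemma P_scale:
  assumes "smooth_fun A h"
  shows "P (\<lambda>q. r * h q) p = r * P h p"
proof -
  have "X i p (\<lambda>q. X i q (\<lambda>q. r * h q)) = r * X i p (\<lambda>q. X i q h)" if "i \<in> I" for i
    using that assms by (simp add: smooth_vfield_apply_scale[OF X] smooth_intros)
  then show ?thesis
    using assms by (simp add: P_def smooth_vfield_apply_scale[OF Y] sum_distrib_left algebra_simps)
qed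

text \<open>In the second derivatives of a product the two mixed terms coincide, which gives the
  factor 2. Multiplication by \<open>c\<close> commutes with multiplication by \<open>f\<close>, so
  \<open>h\<close> is multiplied by \<open>P f\<close> without its zeroth order term.\<close>

lemma mult_commutator_P:
  assumes f: "smooth_fun A f" and h: "smooth_fun A h"
  shows "mult_commutator P f h p = 2 * (\<Sum>i\<in>I. X i p f * X i p h) + (P f p - c p * f p) * h p"
proof -
  have "X i p (\<lambda>q. X i q (\<lambda>q. f q * h q)) =
      f p * X i p (\<lambda>q. X i q h) + 2 * (X i p f * X i p h) + X i p (\<lambda>q. X i q f) * h p"
    if i: "i \<in> I" for i
  proof -
    have "X i p (\<lambda>q. X i q (\<lambda>q. f q * h q)) = X i p (\<lambda>q. f q * X i q h + X i q f * h q)"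
      by (simp add: smooth_vfield_apply_mult[OF X[OF i] f h])
    also have "\<dots> = X i p (\<lambda>q. f q * X i q h) + X i p (\<lambda>q. X i q f * h q)"
      using i f h by (intro smooth_vfield_apply_add[OF X] smooth_intros)
    finally show ?thesis
      using i f h by (simp add: smooth_vfield_apply_mult[OF X] smooth_intros)
  qed
  then show ?thesis
    by (simp add: mult_commutator_def P_def smooth_vfield_apply_mult[OF Y f h] sum.distrib
        sum_distrib_left sum_distrib_right algebra_simps)
qed

text \<open>The first commutator is a derivation plus a multiplication operator. Commuting with
  \<open>g\<close> cancels the multiplication part and leaves only the derivation evaluated at
  \<open>g\<close>, again as a factor of \<open>h\<close>.\<close>

lemma mult_commutator_mult_commutator_P:
  assumes f: "smooth_fun A f" and g: "smooth_fun A g" and h: "smooth_fun A h"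
  shows "mult_commutator (mult_commutator P f) g h p = 2 * (\<Sum>i\<in>I. X i p f * X i p g) * h p"
proof -
  have "(\<Sum>i\<in>I. X i p f * X i p (\<lambda>q. g q * h q)) =
      g p * (\<Sum>i\<in>I. X i p f * X i p h) + (\<Sum>i\<in>I. X i p f * X i p g) * h p"
    by (simp add: smooth_vfield_apply_mult[OF X g h] sum.distrib sum_distrib_left
        sum_distrib_right algebra_simps)
  then show ?thesis
    \<comment> \<open>Only the outer commutator is unfolded, so that the formula for the inner one
      still applies.\<close>
    unfolding mult_commutator_def[of "mult_commutator P f"]
    using f g h by (simp add: mult_commutator_P smooth_intros algebra_simps)
qed

lemma diff_operator_order2_P: "diff_operator_order2 A P"
  unfolding diff_operator_order2_def
proof (intro conjI allI impI ext)
  fix f g k h :: "'a \<Rightarrow> real" and p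
  assume "smooth_fun A f" "smooth_fun A g" "smooth_fun A k" "smooth_fun A h"
  \<comment> \<open>The double commutator is multiplication by a function, hence commutes with
    multiplication by \<open>k\<close>.\<close>
  then show "mult_commutator (mult_commutator (mult_commutator P f) g) k h p = 0"
    unfolding mult_commutator_def[of "mult_commutator (mult_commutator P f) g"]
    by (simp add: mult_commutator_mult_commutator_P smooth_intros)
qed (use smooth_P P_add P_scale in auto)

lemma principal_symbol2_P:
  "smooth_fun A f \<Longrightarrow> principal_symbol2 P f p = (\<Sum>i\<in>I. (X i p f)\<^sup>2)"
  by (simp add: principal_symbol2_def mult_commutator_mult_commutator_P smooth_fun_const
      power2_eq_square)

text \<open>The assumption \<open>span\<close> is the dual form of spanning: a differential that
  vanishes on all \<open>X i p\<close> vanishes on the whole tangent space.\<close>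

lemma elliptic_order2_P:
  assumes "finite I"
    and span: "\<And>p D f. D \<in> tangent_space A p \<Longrightarrow> (\<And>i. i \<in> I \<Longrightarrow> X i p f = 0) \<Longrightarrow> D f = 0"
  shows "elliptic_order2 A P"
  unfolding elliptic_order2_def
proof (intro conjI allI impI diff_operator_order2_P notI)
  fix p and f :: "'a \<Rightarrow> real"
  assume f: "smooth_fun A f" and D: "\<exists>D\<in>tangent_space A p. D f \<noteq> 0"
    and "principal_symbol2 P f p = 0"
  then have "\<forall>i\<in>I. X i p f = 0"
    \<comment> \<open>Finiteness enters here: over an infinite \<open>I\<close> the sum would be 0
      by convention and say nothing about its terms.\<close>
    using \<open>finite I\<close> by (simp add: principal_symbol2_P sum_nonneg_eq_0_iff)
  then show False using span D by blast
qed

end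

section \<open>Smooth coefficients and ellipticity of the operator in the system\<close>

lemma smooth_fun_alpha:
  assumes "smooth_manifold A" "structure_functions A J n Vd Wd lam" "k \<in> {1..n}"
  shows "smooth_fun A (alpha n lam k)"
  unfolding alpha_def[abs_def]
  using assms(2,3) by (intro smooth_fun_sum[OF assms(1)]) (auto simp: structure_functions_def)

lemma smooth_fun_R_fun:
  assumes man: "smooth_manifold A" and frame: "global_frame A n V W"
    and lam: "structure_functions A J n Vd Wd lam"
  shows "smooth_fun A (R_fun n V W lam m)"
proof -
  let ?\<alpha> = "alpha n lam"
  note alp = smooth_fun_alpha[OF man lam]
  have VW: "smooth_vfield A (V k)" "smooth_vfield A (W k)" if "k \<in> {1..n}" for k
    using frame that by (auto simp: global_frame_def)
  have lam': "smooth_fun A (lam i k k)" if "i \<in> {1..n}" "k \<in> {1..n}" for i k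
    using lam that by (auto simp: structure_functions_def)
  note lin = smooth_fun_bounded_linear[OF man bounded_linear_Re]
    smooth_fun_bounded_linear[OF man bounded_linear_Im]
  \<comment> \<open>In the real part of \<open>XX V W k\<close> applied to
    \<open>alpha n lam k\<close>, the factor \<open>- \<i>\<close> before \<open>W k\<close> pairs
    \<open>W k\<close> with the imaginary part, with a plus sign. The result is a purely real
    expression to which the closure rules apply.\<close>
  have R_eq: "R_fun n V W lam m = (\<lambda>p. \<Sum>k=1..n.
      1/2 * V k p (\<lambda>q. Re (?\<alpha> k q)) + 1/2 * W k p (\<lambda>q. Im (?\<alpha> k q))
      - real m * (Re (?\<alpha> k p) * Re (?\<alpha> k p) + Im (?\<alpha> k p) * Im (?\<alpha> k p))
      - (\<Sum>i=1..n. Re (lam i k k p) * Re (?\<alpha> i p) + Im (lam i k k p) * Im (?\<alpha> i p)))"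
    by (rule ext, unfold R_fun_def Re_sum)
      (rule sum.cong, auto simp: cvfield_apply_def XX_def tvec_capply_def cmod_power2
        simp flip: power2_eq_square)
  show ?thesis
    unfolding R_eq
    by (intro smooth_fun_add[OF man] smooth_fun_diff[OF man] smooth_fun_mult[OF man]
        smooth_fun_sum[OF man] smooth_fun_const smooth_vfield_smooth_fun[OF VW(1)]
        smooth_vfield_smooth_fun[OF VW(2)] lin alp lam')
qed

lemma elliptic_order2_L_op_zeroth_order:
  assumes man: "smooth_manifold A" and frame: "global_frame A n V W"
    and lam: "structure_functions A J n Vd Wd lam" and c: "smooth_fun A c"
  shows "elliptic_order2 A (\<lambda>h p. L_op n V W lam m h p + c p * h p)"
proof -
  let ?\<alpha> = "alpha n lam" and ?I = "{1..n} <+> {1..n}"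
  note alp = smooth_fun_alpha[OF man lam]
  have VW: "smooth_vfield A (V k)" "smooth_vfield A (W k)" if "k \<in> {1..n}" for k
    using frame that by (auto simp: global_frame_def)
  have lam': "smooth_fun A (lam i k k)" if "i \<in> {1..n}" "k \<in> {1..n}" for i k
    using lam that by (auto simp: structure_functions_def)
  note lin = smooth_fun_bounded_linear[OF man bounded_linear_Re]
    smooth_fun_bounded_linear[OF man bounded_linear_Im]
  \<comment> \<open>All first order terms of \<open>L_op\<close> go into one vector field. Signs are
    moved into the coefficients so that it is visibly a sum of smooth multiples of frame
    fields.\<close>
  define Y where "Y = (\<lambda>p h. \<Sum>k=1..n.
        (- 4 * real m * Re (?\<alpha> k p)) * V k p h
        + (- 4 * real m * Im (?\<alpha> k p)) * W k p h
        + (\<Sum>i=1..n. (- 2 * Re (lam i k k p)) * V i p h)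
        + (\<Sum>i=1..n. (- 2 * Im (lam i k k p)) * W i p h))"
  have Y: "smooth_vfield A Y"
    unfolding Y_def
    by (intro smooth_vfield_sum[OF man] smooth_vfield_add[OF man] smooth_vfield_mult[OF man]
        smooth_fun_mult[OF man] smooth_fun_const lin alp lam' VW)
  \<comment> \<open>The squares of the \<open>V k\<close> and \<open>W k\<close> form the second
    order part of \<open>L_op\<close>; \<open>case_sum\<close> lists them as a single
    family.\<close>
  interpret sum_of_squares A ?I "case_sum V W" Y c
    by unfold_locales (use man VW Y c in auto)
  have P_eq: "P = (\<lambda>h p. L_op n V W lam m h p + c p * h p)"
    unfolding P_def[abs_def]
    by (intro ext) (simp add: L_op_def Y_def sum.Plus sum.distrib sum_subtractf
        sum_distrib_left sum_negf algebra_simps)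
  have "elliptic_order2 A P"
  proof (rule elliptic_order2_P)
    show "finite ?I" by simp
  next
    fix p D f
    assume D: "D \<in> tangent_space A p" and zero: "\<And>i. i \<in> ?I \<Longrightarrow> case_sum V W i p f = 0"
    obtain a b where "D = (\<lambda>f. \<Sum>i=1..n. a i * V i p f + b i * W i p f)"
      using frame D unfolding global_frame_def by meson
    moreover have "V i p f = 0 \<and> W i p f = 0" if "i \<in> {1..n}" for i
      using zero[OF InlI[OF that]] zero[OF InrI[OF that]] by simp
    ultimately show "D f = 0" by simp
  qed
  then show ?thesis by (simp only: P_eq)
qed

theorem proposition4p5:
  fixes A :: "('a::{t2_space,second_countable_topology}, 'e::euclidean_space) atlas"
    and J :: "'a \<Rightarrow> 'a tvec \<Rightarrow> 'a tvec"
    and V W :: "nat \<Rightarrow> 'a vfield"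
    and Vd Wd :: "nat \<Rightarrow> 'a \<Rightarrow> 'a tvec \<Rightarrow> real"
    and lam :: "nat \<Rightarrow> nat \<Rightarrow> nat \<Rightarrow> 'a \<Rightarrow> complex"
    and n m :: nat
  assumes "smooth_manifold A"
    and "DIM('e) = 2 * n"
    and "almost_complex_structure A J"
    and "global_frame A n V W"
    and "\<forall>i\<in>{1..n}. \<forall>p. J p (V i p) = W i p \<and> J p (W i p) = (\<lambda>f. - V i p f)"
    and "dual_coframe A n V W Vd Wd"
    and "structure_functions A J n Vd Wd lam"
    and "m \<ge> 1"
    and "\<forall>p. beta n V W lam p \<in> \<real>"
  shows "elliptic_order2 A (\<lambda>h p. L_op n V W lam m h p - 4 * real m * R_fun n V W lam m p * h p) \<and>
    (\<forall>u v :: 'a \<Rightarrow> real. smooth_fun A u \<longrightarrow> smooth_fun A v \<longrightarrow>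
      ((\<forall>p. L_op n V W lam m v p - 4 * real m * R_fun n V W lam m p * v p
              - 4 * real m * Im (beta n V W lam p) * u p = 0 \<and>
            - L_op n V W lam m u p + 4 * real m * R_fun n V W lam m p * u p
              - 4 * real m * Im (beta n V W lam p) * v p = 0)
       \<longleftrightarrow>
       (\<forall>p. L_op n V W lam m u p - 4 * real m * R_fun n V W lam m p * u p = 0) \<and>
       (\<forall>p. L_op n V W lam m v p - 4 * real m * R_fun n V W lam m p * v p = 0)))"
proof (rule conjI)
  let ?c = "\<lambda>p. (- 4 * real m) * R_fun n V W lam m p"
  have "smooth_fun A ?c"
    by (intro smooth_fun_mult[OF assms(1)] smooth_fun_const
        smooth_fun_R_fun[OF assms(1,4,7)])
  from elliptic_order2_L_op_zeroth_order[OF assms(1,4,7) this]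
  show "elliptic_order2 A
      (\<lambda>h p. L_op n V W lam m h p - 4 * real m * R_fun n V W lam m p * h p)"
    by simp
next
  \<comment> \<open>Once the coupling terms vanish, the second equation of the system is the
    negative of the equation for \<open>u\<close>.\<close>
  have "Im (beta n V W lam p) = 0" for p
    using assms(9) by (simp add: complex_is_Real_iff)
  then show "\<forall>u v :: 'a \<Rightarrow> real. smooth_fun A u \<longrightarrow> smooth_fun A v \<longrightarrow>
      ((\<forall>p. L_op n V W lam m v p - 4 * real m * R_fun n V W lam m p * v p
              - 4 * real m * Im (beta n V W lam p) * u p = 0 \<and>
            - L_op n V W lam m u p + 4 * real m * R_fun n V W lam m p * u p
              - 4 * real m * Im (beta n V W lam p) * v p = 0)
       \<longleftrightarrow>
       (\<forall>p. L_op n V W lam m u p - 4 * real m * R_fun n V W lam m p * u p = 0) \<and>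
       (\<forall>p. L_op n V W lam m v p - 4 * real m * R_fun n V W lam m p * v p = 0))"
    by auto
qed

end
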